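(* Let $(a,b)\in\mathbb{R}^2$ satisfy $\sqrt{2}<a<2$ and $$\max\left\{\tfrac{1}{8}\left(3a^2-8a+\sqrt{9a^4-16a^3}\right),\ 2-\sqrt{2}\,a\right\}<b<0,$$ where the first entry of the maximum is taken into account only when it is a real number (i.e. when $a\ge 16/9$). Let $f=f_{(a,b)}$ be the Lozi map and $X=\left(\frac{1}{1+a-b},\frac{b}{1+a-b}\right)$ its fixed point. Then $f$ is topologically mixing on the unstable manifold $W^u_X$ of $X$ (with the topology induced from $\mathbb{R}^2$).
   Context: The Lozi map is $f_{(a,b)}:\mathbb{R}^2\to\mathbb{R}^2$, $f_{(a,b)}(x,y)=(1+y-a|x|,\,bx)$; for $b\neq0$ it is a homeomorphism. For a homeomorphism $g$ of a metric space $(M,d)$, a local unstable manifold at $q$ is a set $W^u_{q,\epsilon,loc}=\{r\in M:\lim_{n\to\infty}d(g^{-n}(q),g^{-n}(r))=0 \text{ and } d(g^{-i}(q),g^{-i}(r))<\epsilon \text{ for every } i\in\mathbb{N}\}$ for some $\epsilon>0$; the (global) unstable manifold is $W^u_q=\bigcup_{n\in\mathbb{N}}g^n(W^u_{g^{-n}(q),loc})$. A map $h:S\to S$ is (topologically) mixing if for any nonempty open sets $W,V\subset S$ one has $h^i(W)\cap V\neq\emptyset$ for all but finitely many $i\in\mathbb{N}$. *)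

theory Defs
  imports "HOL-Analysis.Analysis"
begin

definition lozi :: "real \<Rightarrow> real \<Rightarrow> real \<times> real \<Rightarrow> real \<times> real" where
  "lozi a b = (\<lambda>(x, y). (1 + y - a * \<bar>x\<bar>, b * x))"

definition lozi_fixpoint :: "real \<Rightarrow> real \<Rightarrow> real \<times> real" where
  "lozi_fixpoint a b = (1 / (1 + a - b), b / (1 + a - b))"

text \<open>
  The next two definitions are meant for homeomorphisms \<open>g\<close> of the whole space, for which
  \<open>inv g ^^ i\<close> is the iterate \<open>g\<^sup>-\<^sup>i\<close>.  The size \<open>\<epsilon>\<close> of the local manifolds is kept as a
  parameter.
\<close>

definition local_unstable_manifold ::
    "('a::metric_space \<Rightarrow> 'a) \<Rightarrow> real \<Rightarrow> 'a \<Rightarrow> 'a set" where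
  "local_unstable_manifold g \<epsilon> q =
    {r. (\<lambda>n. dist ((inv g ^^ n) q) ((inv g ^^ n) r)) \<longlonglongrightarrow> 0 \<and>
        (\<forall>i. dist ((inv g ^^ i) q) ((inv g ^^ i) r) < \<epsilon>)}"

definition unstable_manifold ::
    "('a::metric_space \<Rightarrow> 'a) \<Rightarrow> real \<Rightarrow> 'a \<Rightarrow> 'a set" where
  "unstable_manifold g \<epsilon> q =
    (\<Union>n. (g ^^ n) ` local_unstable_manifold g \<epsilon> ((inv g ^^ n) q))"

text \<open>Invariance of \<open>S\<close> is part of the notion: \<open>h\<close> has to restrict to a self-map of \<open>S\<close>.\<close>

definition topologically_mixing_on ::
    "'a::topological_space set \<Rightarrow> ('a \<Rightarrow> 'a) \<Rightarrow> bool" where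
  "topologically_mixing_on S h \<longleftrightarrow>
    h ` S \<subseteq> S \<and>
    (\<forall>W V. openin (top_of_set S) W \<and> openin (top_of_set S) V \<and> W \<noteq> {} \<and> V \<noteq> {} \<longrightarrow>
      finite {i. (h ^^ i) ` W \<inter> V = {}})"

lemma homeomorphism_lozi:
  assumes "b \<noteq> 0"
  shows "homeomorphism UNIV UNIV (lozi a b) (inv (lozi a b))"
proof -
  define k where "k = (\<lambda>(u, v). (v / b, u - 1 + a * \<bar>v / b\<bar>) :: real \<times> real)"
  have 1: "k (lozi a b p) = p" and 2: "lozi a b (k p) = p" for p
    using assms by (auto simp: k_def lozi_def abs_mult split: prod.splits)
  have "inv (lozi a b) = k"
    using 1 2 by (intro inv_unique_comp) auto
  moreover have "continuous_on UNIV (lozi a b)" "continuous_on UNIV k"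
    unfolding lozi_def k_def case_prod_beta using assms by (auto intro!: continuous_intros)
  ultimately show ?thesis
    using 1 2 by (intro homeomorphismI) auto
qed

lemma lozi_fixpoint:
  assumes "1 + a - b > 0"
  shows "lozi a b (lozi_fixpoint a b) = lozi_fixpoint a b"
proof -
  have "\<bar>1 / (1 + a - b)\<bar> = 1 / (1 + a - b)"
    using assms by simp
  then have "1 + b / (1 + a - b) - a * \<bar>1 / (1 + a - b)\<bar> = 1 / (1 + a - b)"
    using assms by (simp only:) (simp add: divide_simps)
  then show ?thesis
    by (simp add: lozi_def lozi_fixpoint_def)
qed

end

theory Submission
  imports Defs
begin

text \<open>
  The condition \<open>2 - sqrt 2 * a < b\<close> says that the eigenvalues \<open>- \<mu>\<close>, \<open>- \<kappa>\<close> at \<open>X\<close> satisfy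
  \<open>\<mu> > sqrt 2\<close>; the other lower bound on \<open>b\<close> is equivalent to the invariance of a triangle \<open>T\<close>
  that contains a neighbourhood of \<open>X\<close>.  A segment in \<open>T\<close> of slope at most \<open>\<kappa>\<close> is stretched
  horizontally by at least \<open>\<mu>\<close>, so, although it may be cut in half at the vertical axis, it grows
  until one of its images joins both axes inside \<open>T\<close>.  Such a segment crosses the stable line of
  \<open>X\<close> transversally, and so its images accumulate on the local, hence on the whole, unstable manifold.
\<close>

section \<open>The unstable manifold of a fixed point\<close>

text \<open>As \<open>q\<close> is fixed, all local manifolds in the union are based at
  \<open>q\<close>. Shifting the index does not affect limits, and a backward orbit tending to
  \<open>q\<close> has a tail closer to \<open>q\<close> than \<open>\<epsilon>\<close>; so the size
  \<open>\<epsilon>\<close> drops out.\<close>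

lemma unstable_manifold_fixpoint:
  fixes g :: "'a::metric_space \<Rightarrow> 'a"
  assumes "bij g" "g q = q" "\<epsilon> > 0"
  shows "unstable_manifold g \<epsilon> q = {r. (\<lambda>n. (inv g ^^ n) r) \<longlonglongrightarrow> q}" (is "_ = ?R")
proof -
  have invg: "inv g (g x) = x" "g (inv g x) = x" for x
    using assms(1) by (auto simp: bij_is_inj bij_is_surj surj_f_inv_f)
  have q: "(inv g ^^ n) q = q" for n
    using invg(1)[of q] assms(2) by (induction n) auto
  have gn: "(inv g ^^ n) ((g ^^ n) x) = x" "(g ^^ n) ((inv g ^^ n) x) = x" for n x
    using assms(1) invg by (induction n arbitrary: x) (simp_all add: funpow_swap1)
  show ?thesis
  proof (intro set_eqI iffI)
    fix r assume "r \<in> unstable_manifold g \<epsilon> q"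
    then obtain n s where s: "r = (g ^^ n) s" "(\<lambda>i. dist q ((inv g ^^ i) s)) \<longlonglongrightarrow> 0"
      by (auto simp: unstable_manifold_def local_unstable_manifold_def q)
    have "(inv g ^^ (i + n)) r = (inv g ^^ i) s" for i
      by (simp add: funpow_add s gn)
    moreover have "(\<lambda>i. (inv g ^^ i) s) \<longlonglongrightarrow> q"
      using s(2) by (subst tendsto_dist_iff) (simp add: dist_commute)
    ultimately show "r \<in> ?R"
      using LIMSEQ_offset[of "\<lambda>i. (inv g ^^ i) r" n q] by simp
  next
    fix r assume "r \<in> ?R"
    then have lim: "(\<lambda>i. (inv g ^^ i) r) \<longlonglongrightarrow> q" by simp
    then obtain N where N: "\<And>i. i \<ge> N \<Longrightarrow> dist ((inv g ^^ i) r) q < \<epsilon>"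
      using assms(3) by (auto simp: lim_sequentially)
    have shift: "(inv g ^^ i) ((inv g ^^ N) r) = (inv g ^^ (i + N)) r" for i
      by (simp add: funpow_add)
    have "(\<lambda>i. (inv g ^^ (i + N)) r) \<longlonglongrightarrow> q"
      using lim by (rule LIMSEQ_ignore_initial_segment)
    then have "(\<lambda>i. dist q ((inv g ^^ (i + N)) r)) \<longlonglongrightarrow> 0"
      by (subst (asm) tendsto_dist_iff) (simp add: dist_commute)
    then have "(inv g ^^ N) r \<in> local_unstable_manifold g \<epsilon> ((inv g ^^ N) q)"
      using N by (auto simp: local_unstable_manifold_def q shift dist_commute)
    from imageI[OF this, of "g ^^ N"] show "r \<in> unstable_manifold g \<epsilon> q"
      unfolding unstable_manifold_def gn(2) by (rule UN_I[OF UNIV_I])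
  qed
qed

section \<open>Segments and the eigenvalue parameters\<close>

lemma image_funpow_Suc: "(g ^^ Suc n) ` A = g ` (g ^^ n) ` A"
  by (simp only: funpow.simps image_comp)

text \<open>The line is recorded by its height \<open>m\<close> on the vertical axis, where the Lozi
  map folds the plane: the cut point is \<open>(0, m)\<close> and its image is
  \<open>(1 + m, 0)\<close>.\<close>

definition seg :: "real \<Rightarrow> real \<Rightarrow> real \<Rightarrow> real \<Rightarrow> (real \<times> real) set" where
  "seg m s l r = (\<lambda>x. (x, m + s * x)) ` {l..r}"

text \<open>With \<open>a = \<mu> + \<kappa>\<close> and \<open>b = - (\<kappa> * \<mu>)\<close> the
  unstable direction at \<open>X\<close> has slope \<open>\<kappa>\<close> and the stable one slope
  \<open>\<mu>\<close>; left of the vertical axis eigenvalues and slopes change sign.\<close>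

locale lozi_eigenvalues =
  fixes \<mu> \<kappa> :: real
  assumes mu_gt: "sqrt 2 < \<mu>"
    and kappa_pos: "0 < \<kappa>"
    and trap: "\<mu>\<^sup>2 + 3 * \<kappa> * \<mu> < 2 * (\<mu> + \<kappa>)"
begin

abbreviation f :: "real \<times> real \<Rightarrow> real \<times> real" where
  "f \<equiv> lozi (\<mu> + \<kappa>) (- (\<kappa> * \<mu>))"

abbreviation X :: "real \<times> real" where
  "X \<equiv> lozi_fixpoint (\<mu> + \<kappa>) (- (\<kappa> * \<mu>))"

definition x0 :: real where
  "x0 = 1 / ((1 + \<kappa>) * (1 + \<mu>))"

text \<open>
  The sides of the triangle \<open>T\<close> lie on the stable and the unstable line of the fixed point in the
  left half plane and on the mirror image of the latter in the horizontal axis; the assumption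
  \<open>trap\<close> says that the right vertex is mapped above the stable line.
\<close>

definition T :: "(real \<times> real) set" where
  "T = {(x, y). 0 \<le> \<mu> * x + y + \<mu> / (\<mu> - 1) \<and> \<bar>y\<bar> \<le> \<kappa> * (1 / (1 - \<kappa>) - x)}"

lemma mu_sq: "2 < \<mu>\<^sup>2"
  using mu_gt by (metis real_sqrt_less_iff real_sqrt_abs abs_of_pos less_trans real_sqrt_gt_zero zero_less_numeral)

lemma mu_gt1: "1 < \<mu>"
  using mu_gt by (smt (verit) real_sqrt_gt_1_iff)

text \<open>Solved for \<open>\<kappa>\<close>, \<open>trap\<close> reads
  \<open>\<kappa> * (3 * \<mu> - 2) < \<mu> * (2 - \<mu>)\<close>. Inserting
  \<open>\<kappa> \<ge> 2 - \<mu>\<close> forces \<open>\<mu> > 2\<close>, and then the left side of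
  \<open>trap\<close> exceeds the right one.\<close>

lemma sum_lt2: "\<mu> + \<kappa> < 2"
proof (rule ccontr)
  assume "\<not> ?thesis"
  then have "(2 - \<mu>) * (3 * \<mu> - 2) \<le> \<kappa> * (3 * \<mu> - 2)"
    using mu_gt1 by (intro mult_right_mono) auto
  then have "2 * (\<mu> - 1) * (2 - \<mu>) < 0"
    using trap by (simp add: power2_eq_square algebra_simps)
  then have "2 < \<mu>"
    using mu_gt1 by (simp add: mult_less_0_iff)
  then have "2 * \<mu> < \<mu>\<^sup>2" "2 * \<kappa> < \<kappa> * \<mu>"
    using kappa_pos by (auto simp: power2_eq_square)
  moreover have "0 < \<kappa> * \<mu>" using kappa_pos mu_gt1 by simp
  moreover have "\<mu>\<^sup>2 + 3 * (\<kappa> * \<mu>) < 2 * \<mu> + 2 * \<kappa>"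
    using trap by (simp add: mult.assoc)
  ultimately show False by linarith
qed

lemma kappa_lt1: "\<kappa> < 1"
  using sum_lt2 mu_gt1 by simp

text \<open>Points of \<open>T\<close> on the vertical axis have height at most the left side in
  modulus, and the stable line of \<open>X\<close> meets the axis at depth equal to the right side;
  so these points lie above that line. Once \<open>trap\<close> is solved for
  \<open>\<kappa>\<close>, the claim reduces to \<open>2 \<le> \<mu>\<^sup>2\<close>.\<close>

lemma axis_bound: "\<kappa> / (1 - \<kappa>) < \<mu> / (1 + \<mu>)"
proof -
  have "\<kappa> * (3 * \<mu> - 2) < \<mu> * (2 - \<mu>)"
    using trap by (simp add: power2_eq_square algebra_simps)
  then have "\<kappa> * (3 * \<mu> - 2) * (1 + 2 * \<mu>) < \<mu> * (2 - \<mu>) * (1 + 2 * \<mu>)"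
    using mu_gt1 by simp
  also have "\<dots> \<le> \<mu> * (3 * \<mu> - 2)"
  proof -
    have "(2 - \<mu>) * (1 + 2 * \<mu>) \<le> 3 * \<mu> - 2"
      using mu_sq by (simp add: power2_eq_square algebra_simps)
    then show ?thesis using mu_gt1 by (simp add: mult.assoc)
  qed
  finally have "(\<kappa> * (1 + 2 * \<mu>)) * (3 * \<mu> - 2) < \<mu> * (3 * \<mu> - 2)"
    by (simp add: algebra_simps)
  then have "\<kappa> * (1 + 2 * \<mu>) < \<mu>"
    using mu_gt1 by (subst (asm) mult_less_cancel_right_pos) auto
  then show ?thesis
    using kappa_lt1 mu_gt1 by (simp add: field_simps)
qed

lemma x0_pos: "0 < x0"
  using kappa_pos mu_gt1 by (simp add: x0_def)

lemma x0_eq: "1 - \<kappa> * \<mu> * x0 - (\<mu> + \<kappa>) * x0 = x0"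
proof -
  have "x0 * ((1 + \<kappa>) * (1 + \<mu>)) = 1"
    using kappa_pos mu_gt1 by (simp add: x0_def)
  then show ?thesis by (simp add: algebra_simps)
qed

lemma X_eq: "X = (x0, - (\<kappa> * \<mu> * x0))"
proof -
  have "1 + (\<mu> + \<kappa>) - - (\<kappa> * \<mu>) = (1 + \<kappa>) * (1 + \<mu>)" by (simp add: algebra_simps)
  then show ?thesis by (simp add: lozi_fixpoint_def x0_def)
qed

lemma f_X: "f X = X"
  using kappa_pos mu_gt1 by (intro lozi_fixpoint) (auto simp: add_pos_pos)

lemma f_homeo: "homeomorphism UNIV UNIV f (inv f)"
  using kappa_pos mu_gt1 by (intro homeomorphism_lozi) auto

lemma bij_f: "bij f"
  using f_homeo unfolding homeomorphism_def bij_def inj_def by (metis UNIV_I)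

lemma continuous_f_pow: "continuous_on UNIV (f ^^ n)"
proof (induction n)
  case (Suc n)
  then have "continuous_on UNIV (f \<circ> (f ^^ n))"
    using f_homeo by (intro continuous_on_compose) (auto simp: homeomorphism_def intro: continuous_on_subset)
  then show ?case by simp
qed (simp add: id_def)

section \<open>Invariance of the triangle\<close>

text \<open>Left of the vertical axis the form \<open>\<mu> * x + y + w\<close> is multiplied by
  \<open>\<mu>\<close>; right of it its value at the image is least for the right vertex, which
  \<open>trap\<close> controls. The two mirror sides follow from the bound on
  \<open>\<bar>y\<bar>\<close> and \<open>1 + \<kappa> * e = e\<close>.\<close>

lemma f_T: assumes "p \<in> T" shows "f p \<in> T"
proof -
  obtain x y where p: "p = (x, y)" by force
  define e where "e = 1 / (1 - \<kappa>)"
  define w where "w = \<mu> / (\<mu> - 1)"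
  have e: "1 + \<kappa> * e = e" and w: "w + \<mu> = \<mu> * w"
    using kappa_lt1 mu_gt1 by (auto simp: e_def w_def field_simps)
  have epos: "0 < e" and wpos: "0 < w"
    using kappa_lt1 mu_gt1 by (auto simp: e_def w_def)
  \<comment> \<open>Multiplied by \<open>(1 - \<kappa>) * (\<mu> - 1)\<close> this is the weak form
    of \<open>trap\<close>: the vertex \<open>(e, 0)\<close> is not mapped below the stable
    side.\<close>
  have H: "(2 * \<kappa> + \<mu>) * e \<le> w"
    using kappa_lt1 mu_gt1 trap by (simp add: e_def w_def field_simps power2_eq_square)
  have A: "0 \<le> \<mu> * x + y + w" and B: "\<bar>y\<bar> \<le> \<kappa> * (e - x)"
    using assms by (auto simp: T_def p e_def w_def)
  show ?thesis
  proof (cases "x \<ge> 0")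
    case True
    have "x \<le> e" using B kappa_pos by (smt (verit) mult_pos_neg)
    have pt: "f p = (1 + y - (\<mu> + \<kappa>) * x, - (\<kappa> * \<mu> * x))"
      using True by (simp add: p lozi_def)
    \<comment> \<open>The extreme case is the lower edge \<open>y = - \<kappa> * (e - x)\<close>,
      and along it the vertex \<open>x = e\<close>.\<close>
    have "(2 * \<kappa> + \<mu>) * x - \<kappa> * (x - e) \<le> (2 * \<kappa> + \<mu>) * e"
    proof -
      have "(\<kappa> + \<mu>) * x \<le> (\<kappa> + \<mu>) * e"
        using \<open>x \<le> e\<close> kappa_pos mu_gt1 by (intro mult_left_mono) auto
      then show ?thesis by (simp add: algebra_simps)
    qed
    with B H have "(2 * \<kappa> + \<mu>) * x - y \<le> w" by (auto simp: algebra_simps)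
    then have "\<mu> * ((2 * \<kappa> + \<mu>) * x - y) \<le> \<mu> * w"
      using mu_gt1 by (intro mult_left_mono) auto
    then have 1: "0 \<le> \<mu> * (1 + y - (\<mu> + \<kappa>) * x) - \<kappa> * \<mu> * x + w"
      using w by (simp add: algebra_simps)
    have "(\<mu> + 2 * \<kappa>) * x + (1 + y - (\<mu> + \<kappa>) * x) \<le> e"
      using B e by (auto simp: algebra_simps)
    moreover have "\<mu> * x \<le> (\<mu> + 2 * \<kappa>) * x"
      using True kappa_pos by (simp add: algebra_simps)
    ultimately have "\<mu> * x \<le> e - (1 + y - (\<mu> + \<kappa>) * x)" by linarith
    then have "\<kappa> * (\<mu> * x) \<le> \<kappa> * (e - (1 + y - (\<mu> + \<kappa>) * x))"
      using kappa_pos by (intro mult_left_mono) auto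
    moreover have "0 \<le> \<kappa> * \<mu> * x" using True kappa_pos mu_gt1 by simp
    ultimately show ?thesis
      using 1 by (simp add: pt T_def e_def w_def mult.assoc)
  next
    case False
    have pt: "f p = (1 + y + (\<mu> + \<kappa>) * x, - (\<kappa> * \<mu> * x))"
      using False by (simp add: p lozi_def)
    have "0 \<le> \<mu> * (\<mu> * x + y + w)" using A mu_gt1 by simp
    then have 1: "0 \<le> \<mu> * (1 + y + (\<mu> + \<kappa>) * x) - \<kappa> * \<mu> * x + w"
      using w by (simp add: algebra_simps)
    have "- (\<mu> * x) \<le> e - (1 + y + (\<mu> + \<kappa>) * x)"
      using B e by (auto simp: algebra_simps)
    then have "\<kappa> * (- (\<mu> * x)) \<le> \<kappa> * (e - (1 + y + (\<mu> + \<kappa>) * x))"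
      using kappa_pos by (intro mult_left_mono) auto
    moreover have "\<kappa> * \<mu> * x \<le> 0" using False kappa_pos mu_gt1 by (simp add: mult_nonneg_nonpos)
    ultimately show ?thesis
      using 1 by (simp add: pt T_def e_def w_def mult.assoc)
  qed
qed

lemma f_pow_T: "J \<subseteq> T \<Longrightarrow> (f ^^ n) ` J \<subseteq> T"
proof (induction n)
  case (Suc n)
  then show ?case unfolding image_funpow_Suc using f_T by blast
qed simp

lemma T_bounded: "\<exists>M. \<forall>(x, y)\<in>T. \<bar>x\<bar> \<le> M"
proof -
  define e where "e = 1 / (1 - \<kappa>)"
  define w where "w = \<mu> / (\<mu> - 1)"
  have "\<bar>x\<bar> \<le> max e ((w + \<kappa> * e) / (\<mu> - \<kappa>))" if "(x, y) \<in> T" for x y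
  proof -
    have A: "0 \<le> \<mu> * x + y + w" and B: "\<bar>y\<bar> \<le> \<kappa> * (e - x)"
      using that by (auto simp: T_def e_def w_def)
    have "x \<le> e" using B kappa_pos by (smt (verit) mult_pos_neg)
    have "0 \<le> \<mu> * x + \<kappa> * (e - x) + w" using A B by linarith
    then have "- x * (\<mu> - \<kappa>) \<le> w + \<kappa> * e" by (simp add: algebra_simps)
    then have "- x \<le> (w + \<kappa> * e) / (\<mu> - \<kappa>)"
      using kappa_lt1 mu_gt1 by (subst pos_le_divide_eq) auto
    with \<open>x \<le> e\<close> show ?thesis by linarith
  qed
  then show ?thesis by blast
qed

text \<open>\<open>X\<close> satisfies the inequalities of \<open>T\<close> strictly, because
  \<open>(1 + \<mu>) * x0 = 1 / (1 + \<kappa>) < 1 / (1 - \<kappa>)\<close> and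
  \<open>\<kappa> < 1\<close>; continuity along the unstable line does the rest.\<close>

lemma X_nbhd_T: "\<exists>\<delta>>0. \<forall>t. \<bar>t\<bar> < \<delta> \<longrightarrow> (x0 + t, - (\<kappa> * \<mu> * x0) + \<kappa> * t) \<in> T"
proof -
  define e where "e = 1 / (1 - \<kappa>)"
  define w where "w = \<mu> / (\<mu> - 1)"
  have 1: "0 < \<mu> * x0 - \<kappa> * \<mu> * x0 + w"
  proof -
    have "\<kappa> * (\<mu> * x0) < 1 * (\<mu> * x0)" using x0_pos mu_gt1 kappa_lt1 by (intro mult_strict_right_mono) auto
    moreover have "0 < w" using mu_gt1 by (simp add: w_def)
    ultimately show ?thesis by (simp add: mult.assoc)
  qed
  have 2: "\<mu> * x0 < e - x0"
  proof -
    have "(1 + \<mu>) * x0 = 1 / (1 + \<kappa>)" using mu_gt1 by (simp add: x0_def)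
    also have "\<dots> < e" using kappa_pos kappa_lt1 by (simp add: e_def field_simps)
    finally show ?thesis by (simp add: algebra_simps)
  qed
  have "((\<lambda>t. \<mu> * (x0 + t) + (- (\<kappa> * \<mu> * x0) + \<kappa> * t) + w) \<longlongrightarrow> \<mu> * (x0 + 0) + (- (\<kappa> * \<mu> * x0) + \<kappa> * 0) + w) (at 0)"
    by (intro tendsto_intros)
  then have E1: "\<forall>\<^sub>F t in at 0. 0 < \<mu> * (x0 + t) + (- (\<kappa> * \<mu> * x0) + \<kappa> * t) + w"
    using 1 by (intro order_tendstoD(1)) (auto simp: algebra_simps)
  have lim: "((\<lambda>t. \<kappa> * (e - (x0 + t)) - \<bar>- (\<kappa> * \<mu> * x0) + \<kappa> * t\<bar>) \<longlongrightarrow> \<kappa> * (e - (x0 + 0)) - \<bar>- (\<kappa> * \<mu> * x0) + \<kappa> * 0\<bar>) (at 0)"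
    by (intro tendsto_intros)
  have "\<kappa> * (\<mu> * x0) < \<kappa> * (e - x0)" using 2 kappa_pos by simp
  moreover have "0 \<le> \<kappa> * \<mu> * x0" using kappa_pos mu_gt1 x0_pos by simp
  ultimately have E2: "\<forall>\<^sub>F t in at 0. 0 < \<kappa> * (e - (x0 + t)) - \<bar>- (\<kappa> * \<mu> * x0) + \<kappa> * t\<bar>"
    by (intro order_tendstoD(1)[OF lim]) (simp add: mult.assoc)
  have "\<forall>\<^sub>F t in at 0. (x0 + t, - (\<kappa> * \<mu> * x0) + \<kappa> * t) \<in> T"
    using E1 E2 by eventually_elim (simp add: T_def e_def w_def)
  then obtain \<delta> where \<delta>: "\<delta> > 0" "\<And>t. t \<noteq> 0 \<Longrightarrow> \<bar>t\<bar> < \<delta> \<Longrightarrow> (x0 + t, - (\<kappa> * \<mu> * x0) + \<kappa> * t) \<in> T"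
    by (auto simp: eventually_at)
  \<comment> \<open>The filter \<open>at 0\<close> omits \<open>t = 0\<close>, the point
    \<open>X\<close> itself.\<close>
  moreover have "(x0 + 0, - (\<kappa> * \<mu> * x0) + \<kappa> * 0) \<in> T"
    using 1 \<open>\<kappa> * (\<mu> * x0) < \<kappa> * (e - x0)\<close> \<open>0 \<le> \<kappa> * \<mu> * x0\<close>
    by (simp add: T_def e_def w_def mult.assoc)
  ultimately show ?thesis by metis
qed

section \<open>Stretching of segments of small slope\<close>

text \<open>Right of the axis the first coordinate of the image is \<open>1 + m - D * x\<close> with
  \<open>D = \<mu> + \<kappa> - s \<ge> \<mu>\<close>, and the new slope
  \<open>\<kappa> * \<mu> / D\<close> is at most \<open>\<kappa>\<close>. The image line passes
  through \<open>(1 + m, 0)\<close>. The right end is kept explicit because it equals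
  \<open>1 + m\<close> when \<open>l = 0\<close>.\<close>

lemma seg_step_right:
  assumes "\<bar>s\<bar> \<le> \<kappa>" "0 \<le> l" "l \<le> r"
  obtains s' m' l' where "\<bar>s'\<bar> \<le> \<kappa>" "m' + s' * (1 + m) = 0"
    "\<mu> * (r - l) \<le> 1 + m + (s - (\<mu> + \<kappa>)) * l - l'"
    "seg m' s' l' (1 + m + (s - (\<mu> + \<kappa>)) * l) \<subseteq> f ` seg m s l r"
proof -
  define D where "D = \<mu> + \<kappa> - s"
  have D: "\<mu> \<le> D" "0 < D" using assms mu_gt1 by (auto simp: D_def)
  define s' where "s' = \<kappa> * \<mu> / D"
  have sD: "s' * D = \<kappa> * \<mu>" using D by (simp add: s'_def)
  have "s' \<le> \<kappa>" "0 \<le> s'"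
    using D kappa_pos mu_gt1 by (auto simp: s'_def field_simps)
  moreover have "\<mu> * (r - l) \<le> D * (r - l)"
    using D assms by (intro mult_right_mono) auto
  moreover have "seg (- s' * (1 + m)) s' (1 + m - D * r) (1 + m - D * l) \<subseteq> f ` seg m s l r"
  proof
    fix p assume "p \<in> seg (- s' * (1 + m)) s' (1 + m - D * r) (1 + m - D * l)"
    then obtain u where u: "1 + m - D * r \<le> u" "u \<le> 1 + m - D * l"
      "p = (u, - s' * (1 + m) + s' * u)" by (auto simp: seg_def)
    define x where "x = (1 + m - u) / D"
    have "l \<le> x" "x \<le> r" using u D by (auto simp: x_def field_simps)
    moreover have u': "u = 1 + m - D * x" using D by (simp add: x_def)
    have "p = (1 + m - D * x, - (s' * D * x))" by (simp add: u(3) u' algebra_simps)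
    moreover have "f (x, m + s * x) = (1 + m - D * x, - (\<kappa> * \<mu> * x))"
      using \<open>l \<le> x\<close> assms by (simp add: lozi_def D_def algebra_simps)
    ultimately have "l \<le> x" "x \<le> r" "f (x, m + s * x) = p" by (simp_all only: sD)
    then show "p \<in> f ` seg m s l r" by (force simp: seg_def)
  qed
  ultimately show thesis
    using that[of s' "- s' * (1 + m)" "1 + m - D * r"] by (simp add: D_def algebra_simps)
qed

text \<open>Now \<open>D = \<mu> + \<kappa> + s\<close>, the horizontal order is preserved and the
  new slope is negative. Again the end nearer to the axis becomes the right end of the
  image.\<close>

lemma seg_step_left:
  assumes "\<bar>s\<bar> \<le> \<kappa>" "r \<le> 0" "l \<le> r"
  obtains s' m' l' where "\<bar>s'\<bar> \<le> \<kappa>" "m' + s' * (1 + m) = 0"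
    "\<mu> * (r - l) \<le> 1 + m + (s + (\<mu> + \<kappa>)) * r - l'"
    "seg m' s' l' (1 + m + (s + (\<mu> + \<kappa>)) * r) \<subseteq> f ` seg m s l r"
proof -
  define D where "D = \<mu> + \<kappa> + s"
  have D: "\<mu> \<le> D" "0 < D" using assms mu_gt1 by (auto simp: D_def)
  define s' where "s' = - (\<kappa> * \<mu> / D)"
  have sD: "s' * D = - (\<kappa> * \<mu>)" using D by (simp add: s'_def)
  have "- \<kappa> \<le> s'" "s' \<le> 0"
    using D kappa_pos mu_gt1 by (auto simp: s'_def field_simps)
  moreover have "\<mu> * (r - l) \<le> D * (r - l)"
    using D assms by (intro mult_right_mono) auto
  moreover have "seg (- s' * (1 + m)) s' (1 + m + D * l) (1 + m + D * r) \<subseteq> f ` seg m s l r"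
  proof
    fix p assume "p \<in> seg (- s' * (1 + m)) s' (1 + m + D * l) (1 + m + D * r)"
    then obtain u where u: "1 + m + D * l \<le> u" "u \<le> 1 + m + D * r"
      "p = (u, - s' * (1 + m) + s' * u)" by (auto simp: seg_def)
    define x where "x = (u - 1 - m) / D"
    have "l \<le> x" "x \<le> r" using u D by (auto simp: x_def field_simps)
    moreover have u': "u = 1 + m + D * x" using D by (simp add: x_def)
    have "p = (1 + m + D * x, s' * D * x)" by (simp add: u(3) u' algebra_simps)
    moreover have "f (x, m + s * x) = (1 + m + D * x, - (\<kappa> * \<mu>) * x)"
      using \<open>x \<le> r\<close> assms by (simp add: lozi_def D_def algebra_simps)
    ultimately have "l \<le> x" "x \<le> r" "f (x, m + s * x) = p" by (simp_all only: sD)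
    then show "p \<in> f ` seg m s l r" by (force simp: seg_def)
  qed
  ultimately show thesis
    using that[of s' "- s' * (1 + m)" "1 + m + D * l"] by (simp add: D_def algebra_simps)
qed

lemma seg_step:
  assumes "\<bar>s\<bar> \<le> \<kappa>" "l \<le> r" "\<not> (l < 0 \<and> 0 < r)"
  obtains s' m' l' r' where "\<bar>s'\<bar> \<le> \<kappa>" "\<mu> * (r - l) \<le> r' - l'"
    "seg m' s' l' r' \<subseteq> f ` seg m s l r"
proof (cases "0 \<le> l")
  case True
  then show thesis using assms seg_step_right[of s l r m] that by metis
next
  case False
  then have "r \<le> 0" using assms by auto
  then show thesis using assms seg_step_left[of s r l m] that by metis
qed

text \<open>
  A segment is cut at most once in two consecutive steps, unless one of its images
  joins the two axes; so its length grows at least by \<open>\<mu>\<^sup>2 / 2 > 1\<close>.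
\<close>

lemma seg_grow:
  assumes s: "\<bar>s\<bar> \<le> \<kappa>" and lr: "l < r" and sub: "seg m s l r \<subseteq> (f ^^ n) ` J"
    and no: "\<And>n m s p. \<lbrakk>\<bar>s\<bar> \<le> \<kappa>; 0 < p; m + s * p = 0; (0, p - 1) \<in> (f ^^ n) ` J;
        seg m s 0 p \<subseteq> (f ^^ Suc n) ` J\<rbrakk> \<Longrightarrow> False"
  shows "\<exists>n' m' s' l' r'. \<bar>s'\<bar> \<le> \<kappa> \<and> seg m' s' l' r' \<subseteq> (f ^^ n') ` J \<and>
      \<mu>\<^sup>2 / 2 * (r - l) \<le> r' - l'"
proof -
  have image: "S \<subseteq> (f ^^ Suc i) ` J" if "S \<subseteq> f ` S'" "S' \<subseteq> (f ^^ i) ` J" for S S' i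
    unfolding image_funpow_Suc using order_trans[OF that(1) image_mono[OF that(2)]] .
  show ?thesis
  proof (cases "l < 0 \<and> 0 < r")
    case False
    obtain s' m' l' r' where 1: "\<bar>s'\<bar> \<le> \<kappa>" "\<mu> * (r - l) \<le> r' - l'"
      "seg m' s' l' r' \<subseteq> f ` seg m s l r"
      by (rule seg_step[OF s less_imp_le[OF lr] False])
    \<comment> \<open>A single uncut step is enough: its factor \<open>\<mu>\<close> is at least
      \<open>\<mu>\<^sup>2 / 2\<close>, as \<open>\<mu> < 2\<close>.\<close>
    have "\<mu> * (\<mu> * (r - l)) \<le> 2 * (\<mu> * (r - l))"
      using lr sum_lt2 kappa_pos mu_gt1 by (intro mult_right_mono) auto
    moreover have "\<mu>\<^sup>2 / 2 * (r - l) = \<mu> * (\<mu> * (r - l)) / 2"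
      by (simp add: power2_eq_square)
    ultimately have "\<mu>\<^sup>2 / 2 * (r - l) \<le> r' - l'" using 1(2) by linarith
    with 1(1) image[OF 1(3) sub] show ?thesis by blast
  next
    case True
    have sub0: "seg m s l' r' \<subseteq> seg m s l r" if "l \<le> l'" "r' \<le> r" for l' r'
      using that by (auto simp: seg_def)
    have m: "(0, m) \<in> (f ^^ n) ` J"
      using True sub by (force simp: seg_def)
    \<comment> \<open>The longer half is kept, at the cost of a factor 2. Its end on the vertical
      axis goes to \<open>(1 + m, 0)\<close>, so the image ends on the horizontal axis.\<close>
    have "\<exists>s' m' l'. \<bar>s'\<bar> \<le> \<kappa> \<and> m' + s' * (1 + m) = 0 \<and> \<mu> * (r - l) / 2 \<le> 1 + m - l' \<and>
        seg m' s' l' (1 + m) \<subseteq> f ` seg m s l r"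
    proof (cases "- l \<le> r")
      case c: True
      obtain s' m' l' where 1: "\<bar>s'\<bar> \<le> \<kappa>" "m' + s' * (1 + m) = 0" "\<mu> * r \<le> 1 + m - l'"
        "seg m' s' l' (1 + m) \<subseteq> f ` seg m s 0 r"
        using seg_step_right[OF s order_refl less_imp_le, of r m] True by simp blast
      have "\<mu> * (r - l) \<le> \<mu> * (2 * r)" using c mu_gt1 by (intro mult_left_mono) auto
      with 1 have "\<mu> * (r - l) / 2 \<le> 1 + m - l'" by simp
      moreover have "seg m' s' l' (1 + m) \<subseteq> f ` seg m s l r"
        using 1(4) sub0[of 0 r] True by auto
      ultimately show ?thesis using 1 by blast
    next
      case c: False
      obtain s' m' l' where 1: "\<bar>s'\<bar> \<le> \<kappa>" "m' + s' * (1 + m) = 0" "\<mu> * (- l) \<le> 1 + m - l'"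
        "seg m' s' l' (1 + m) \<subseteq> f ` seg m s l 0"
        using seg_step_left[OF s order_refl less_imp_le, of l m] True by simp blast
      have "\<mu> * (r - l) \<le> \<mu> * (2 * (- l))" using c mu_gt1 by (intro mult_left_mono) auto
      with 1 have "\<mu> * (r - l) / 2 \<le> 1 + m - l'" by simp
      moreover have "seg m' s' l' (1 + m) \<subseteq> f ` seg m s l r"
        using 1(4) sub0[of l 0] True by auto
      ultimately show ?thesis using 1 by blast
    qed
    then obtain s' m' l' where 1: "\<bar>s'\<bar> \<le> \<kappa>" "m' + s' * (1 + m) = 0"
      "\<mu> * (r - l) / 2 \<le> 1 + m - l'" "seg m' s' l' (1 + m) \<subseteq> f ` seg m s l r"
      by blast
    have sub1: "seg m' s' l' (1 + m) \<subseteq> (f ^^ Suc n) ` J"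
      using image[OF 1(4) sub] .
    \<comment> \<open>A second cut would leave a piece from the vertical axis to
      \<open>(1 + m, 0)\<close>. With \<open>p = 1 + m\<close> the earlier cut point
      \<open>(0, m)\<close> is \<open>(0, p - 1)\<close>, and \<open>no\<close> applies.\<close>
    have uncut: "\<not> (l' < 0 \<and> 0 < 1 + m)"
    proof
      assume *: "l' < 0 \<and> 0 < 1 + m"
      then have "seg m' s' 0 (1 + m) \<subseteq> seg m' s' l' (1 + m)" by (auto simp: seg_def)
      with sub1 have "seg m' s' 0 (1 + m) \<subseteq> (f ^^ Suc n) ` J" by blast
      with no[of s' "1 + m" m' n] 1 * m show False by simp
    qed
    have "0 \<le> \<mu> * (r - l) / 2" using lr mu_gt1 by simp
    then have "l' \<le> 1 + m" using 1(3) by linarith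
    then obtain s2 m2 l2 r2 where 2: "\<bar>s2\<bar> \<le> \<kappa>" "\<mu> * (1 + m - l') \<le> r2 - l2"
      "seg m2 s2 l2 r2 \<subseteq> f ` seg m' s' l' (1 + m)"
      using seg_step[OF 1(1) _ uncut] by metis
    have "\<mu> * (\<mu> * (r - l) / 2) \<le> \<mu> * (1 + m - l')"
      using 1(3) mu_gt1 by (intro mult_left_mono) auto
    moreover have "\<mu>\<^sup>2 / 2 * (r - l) = \<mu> * (\<mu> * (r - l) / 2)"
      by (simp add: power2_eq_square)
    ultimately have "\<mu>\<^sup>2 / 2 * (r - l) \<le> r2 - l2" using 2(2) by linarith
    with 2(1) image[OF 2(3) sub1] show ?thesis by blast
  qed
qed

text \<open>Otherwise \<open>seg_grow\<close> could be iterated forever, with lengths growing like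
  powers of \<open>\<mu>\<^sup>2 / 2 > 1\<close> inside the bounded set \<open>T\<close>. The
  condition on \<open>(0, p - 1)\<close> records that \<open>(p, 0)\<close> is the image of a cut
  point in \<open>T\<close>; it bounds \<open>p\<close> from both sides.\<close>

lemma seg_joins_axes:
  assumes s: "\<bar>s\<bar> \<le> \<kappa>" and lr: "l < r" and J: "seg m s l r \<subseteq> T"
  obtains n m' s' p where "\<bar>s'\<bar> \<le> \<kappa>" "0 < p" "m' + s' * p = 0" "(0, p - 1) \<in> T"
    "seg m' s' 0 p \<subseteq> (f ^^ Suc n) ` seg m s l r"
proof (rule ccontr)
  note found = that
  assume neg: "\<not> thesis"
  have no: False if "\<bar>s'\<bar> \<le> \<kappa>" "0 < p" "m' + s' * p = 0" "(0, p - 1) \<in> (f ^^ n) ` seg m s l r"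
    "seg m' s' 0 p \<subseteq> (f ^^ Suc n) ` seg m s l r" for n m' s' p
    using that f_pow_T[OF J, of n] neg found by blast
  have gt1: "1 < \<mu>\<^sup>2 / 2" using mu_sq by simp
  have long: "\<exists>n m' s' l' r'. \<bar>s'\<bar> \<le> \<kappa> \<and> seg m' s' l' r' \<subseteq> (f ^^ n) ` seg m s l r \<and>
      (\<mu>\<^sup>2 / 2) ^ j * (r - l) \<le> r' - l'" for j
  proof (induction j)
    case 0
    have "seg m s l r \<subseteq> (f ^^ 0) ` seg m s l r" "(\<mu>\<^sup>2 / 2) ^ 0 * (r - l) \<le> r - l" by simp_all
    with s show ?case by blast
  next
    case (Suc j)
    then obtain n m' s' l' r' where 1: "\<bar>s'\<bar> \<le> \<kappa>" "seg m' s' l' r' \<subseteq> (f ^^ n) ` seg m s l r"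
      "(\<mu>\<^sup>2 / 2) ^ j * (r - l) \<le> r' - l'" by blast
    have "0 < (\<mu>\<^sup>2 / 2) ^ j * (r - l)" using gt1 lr by (intro mult_pos_pos zero_less_power) linarith+
    then have "l' < r'" using 1(3) by linarith
    have "\<exists>n2 m2 s2 l2 r2. \<bar>s2\<bar> \<le> \<kappa> \<and> seg m2 s2 l2 r2 \<subseteq> (f ^^ n2) ` seg m s l r \<and>
        \<mu>\<^sup>2 / 2 * (r' - l') \<le> r2 - l2"
      by (rule seg_grow[OF 1(1) \<open>l' < r'\<close> 1(2)], rule no)
    then obtain n2 m2 s2 l2 r2 where 2: "\<bar>s2\<bar> \<le> \<kappa>"
      "seg m2 s2 l2 r2 \<subseteq> (f ^^ n2) ` seg m s l r" "\<mu>\<^sup>2 / 2 * (r' - l') \<le> r2 - l2" by blast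
    have "\<mu>\<^sup>2 / 2 * ((\<mu>\<^sup>2 / 2) ^ j * (r - l)) \<le> \<mu>\<^sup>2 / 2 * (r' - l')"
      using 1(3) gt1 by (intro mult_left_mono) auto
    from order_trans[OF this 2(3)] have "(\<mu>\<^sup>2 / 2) ^ Suc j * (r - l) \<le> r2 - l2"
      by (simp only: power_Suc mult.assoc)
    with 2(1,2) show ?case by blast
  qed
  obtain M where M: "\<And>x y. (x, y) \<in> T \<Longrightarrow> \<bar>x\<bar> \<le> M" using T_bounded by blast
  obtain j where j: "2 * M / (r - l) < (\<mu>\<^sup>2 / 2) ^ j" using real_arch_pow[OF gt1] by blast
  obtain n m' s' l' r' where 1: "seg m' s' l' r' \<subseteq> (f ^^ n) ` seg m s l r"
    "(\<mu>\<^sup>2 / 2) ^ j * (r - l) \<le> r' - l'" using long by blast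
  have "2 * M < (\<mu>\<^sup>2 / 2) ^ j * (r - l)"
    using j lr by (simp only: pos_divide_less_eq diff_gt_0_iff_gt)
  then have "2 * M < r' - l'" using 1(2) by linarith
  have "0 < (\<mu>\<^sup>2 / 2) ^ j * (r - l)" using gt1 lr by (intro mult_pos_pos zero_less_power) linarith+
  then have "(l', m' + s' * l') \<in> seg m' s' l' r'" "(r', m' + s' * r') \<in> seg m' s' l' r'"
    using 1(2) by (auto simp: seg_def)
  then have "\<bar>l'\<bar> \<le> M" "\<bar>r'\<bar> \<le> M" using 1(1) f_pow_T[OF J, of n] M by blast+
  with \<open>2 * M < r' - l'\<close> show False by linarith
qed

section \<open>Crossing the stable line\<close>

text \<open>The stable line of \<open>X\<close> has slope \<open>\<mu>\<close> and meets the axes in \<open>(1 / (1 + \<mu>), 0)\<close> and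
  \<open>(0, - \<mu> / (1 + \<mu>))\<close>.\<close>

lemma crosses_stable_line:
  assumes s: "\<bar>s\<bar> \<le> \<kappa>" and p: "0 < p" "m + s * p = 0" "(0, p - 1) \<in> T" and m: "(0, m) \<in> T"
  obtains \<tau> where "0 < x0 + \<tau>" "x0 + \<tau> < p" "0 < x0 - \<kappa> * \<tau>"
    "m + s * (x0 + \<tau>) = - (\<kappa> * \<mu> * x0) + \<mu> * \<tau>"
proof -
  define c where "c = \<mu> / (1 + \<mu>)"
  have c1: "1 - c = 1 / (1 + \<mu>)" using mu_gt1 by (simp add: c_def field_simps)
  have x0c: "(1 + \<kappa>) * x0 = 1 - c" using c1 kappa_pos mu_gt1 by (simp add: x0_def)
  have muc: "\<mu> * (1 - c) = c" using c1 by (simp add: c_def)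
  have "\<mu> * ((1 + \<kappa>) * x0) = c" unfolding x0c by (rule muc)
  then have c: "\<mu> * x0 * (1 + \<kappa>) = c" by (simp add: mult_ac)
  \<comment> \<open>The stable line is \<open>y = \<mu> * x - c\<close>. Hence \<open>(0, m)\<close>
    lies above it, and \<open>(p, 0)\<close> lies below it since \<open>p > 1 - c\<close>.\<close>
  have "\<bar>m\<bar> < c" "\<bar>p - 1\<bar> < c"
    using p m axis_bound by (auto simp: T_def c_def)
  then have pc: "1 - c < p" by linarith
  define D where "D = \<mu> - s"
  have D: "0 < D" using s kappa_lt1 mu_gt1 by (simp add: D_def)
  \<comment> \<open>The abscissa where \<open>y = m + s * x\<close> meets the stable line.\<close>
  define x where "x = (m + c) / D"
  have xD: "x * D = m + c" using D by (simp add: x_def)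
  have xpos: "0 < x" using \<open>\<bar>m\<bar> < c\<close> D by (simp add: x_def)
  have "\<mu> * (1 - c) < \<mu> * p" using pc mu_gt1 by simp
  then have "m + c < p * D" using p(2) muc by (simp add: D_def algebra_simps)
  then have xp: "x < p" using D by (simp add: x_def field_simps)
  \<comment> \<open>For \<open>\<tau> = x - x0\<close> this means
    \<open>0 < x0 - \<kappa> * \<tau>\<close>: the image of the crossing point is still right of the
    axis. The upper bound on \<open>p\<close> gives \<open>x * (\<mu> + \<kappa>) < 2 * c\<close>,
    and \<open>2 * \<kappa> * \<mu> \<le> \<mu> + \<kappa>\<close> concludes.\<close>
  have "\<kappa> * x < 1 - c"
  proof -
    have "p \<le> 1 + \<kappa> / (1 - \<kappa>)" using p(3) by (auto simp: T_def)
    also have "\<dots> = 1 / (1 - \<kappa>)" using kappa_lt1 by (simp add: field_simps)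
    finally have pk: "\<kappa> * p \<le> \<kappa> / (1 - \<kappa>)"
      using kappa_pos mult_left_mono[of p "1 / (1 - \<kappa>)" \<kappa>] by simp
    have "- s * (p - x) \<le> \<kappa> * (p - x)"
      using xp s by (intro mult_right_mono) auto
    then have "x * (\<mu> + \<kappa>) \<le> \<kappa> * p + c"
      using xD p(2) by (simp add: D_def algebra_simps)
    also have "\<dots> < 2 * c" using pk axis_bound by (simp add: c_def)
    finally have "x * (\<mu> + \<kappa>) < 2 * c" .
    then have "\<kappa> * (x * (\<mu> + \<kappa>)) < \<kappa> * (2 * c)" using kappa_pos by simp
    also have "\<dots> = 2 * \<kappa> * \<mu> * (1 - c)" using muc by simp
    also have "\<dots> \<le> (\<mu> + \<kappa>) * (1 - c)"
    proof (intro mult_right_mono)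
      have "\<kappa> * (2 * \<mu> - 1) \<le> (2 - \<mu>) * (2 * \<mu> - 1)"
        using sum_lt2 mu_gt1 by (intro mult_right_mono) auto
      also have "\<dots> \<le> \<mu>"
        using zero_le_power2[of "\<mu> - 1"] by (simp add: power2_eq_square algebra_simps)
      finally show "2 * \<kappa> * \<mu> \<le> \<mu> + \<kappa>" by (simp add: algebra_simps)
    qed (use c1 mu_gt1 in auto)
    finally have "(\<kappa> * x) * (\<mu> + \<kappa>) < (1 - c) * (\<mu> + \<kappa>)" by (simp add: algebra_simps)
    then show ?thesis using kappa_pos mu_gt1 by (subst (asm) mult_less_cancel_right_pos) auto
  qed
  show thesis
  proof (rule that[of "x - x0"])
    show "0 < x0 - \<kappa> * (x - x0)" using \<open>\<kappa> * x < 1 - c\<close> x0c by (simp add: algebra_simps)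
    show "m + s * (x0 + (x - x0)) = - (\<kappa> * \<mu> * x0) + \<mu> * (x - x0)"
      using xD c by (simp add: D_def algebra_simps)
  qed (use xpos xp in auto)
qed

section \<open>The inclination lemma and accumulation on the unstable line\<close>

text \<open>Right of the axis \<open>f\<close> is affine, so everything is explicit: the base point
  at offset \<open>\<tau>\<close> on the stable line moves to offset
  \<open>(- \<kappa>) ^ i * \<tau>\<close>, the slope tends to \<open>\<kappa>\<close>, and the
  half-width grows by \<open>\<mu>\<close> until truncated at \<open>c\<close>. The margin
  \<open>c\<close> keeps all pieces right of the axis.\<close>

lemma inclination:
  assumes s: "\<bar>s0\<bar> \<le> \<kappa>" and c: "c \<le> x0" "c \<le> x0 + \<tau>" "c \<le> x0 - \<kappa> * \<tau>" "0 \<le> d"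
    and J: "\<And>t. \<bar>t\<bar> \<le> min c d \<Longrightarrow> (x0 + \<tau> + t, - (\<kappa> * \<mu> * x0) + \<mu> * \<tau> + s0 * t) \<in> J"
  shows "\<exists>s. \<bar>s\<bar> \<le> \<kappa> \<and> \<bar>s - \<kappa>\<bar> \<le> \<kappa> ^ i * (2 * \<kappa>) \<and>
    (\<forall>t. \<bar>t\<bar> \<le> min c (\<mu> ^ i * d) \<longrightarrow>
      (x0 + (- \<kappa>) ^ i * \<tau> + t, - (\<kappa> * \<mu> * x0) + \<mu> * ((- \<kappa>) ^ i * \<tau>) + s * t) \<in> (f ^^ i) ` J)"
proof (induction i)
  case 0
  show ?case using s J by (intro exI[of _ s0]) auto
next
  case (Suc i)
  then obtain s where s: "\<bar>s\<bar> \<le> \<kappa>" "\<bar>s - \<kappa>\<bar> \<le> \<kappa> ^ i * (2 * \<kappa>)" and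
    st: "\<And>t. \<bar>t\<bar> \<le> min c (\<mu> ^ i * d) \<Longrightarrow>
      (x0 + (- \<kappa>) ^ i * \<tau> + t, - (\<kappa> * \<mu> * x0) + \<mu> * ((- \<kappa>) ^ i * \<tau>) + s * t) \<in> (f ^^ i) ` J"
    by blast
  define T' where "T' = (- \<kappa>) ^ i * \<tau>"
  \<comment> \<open>For even \<open>i\<close> the offset \<open>T'\<close> lies between 0 and
    \<open>\<tau>\<close>, for odd \<open>i\<close> between 0 and
    \<open>- \<kappa> * \<tau>\<close>; so the bounds on \<open>c\<close> cover every step.\<close>
  have ci: "c \<le> x0 + T'"
  proof -
    have shrink: "min 0 y \<le> \<kappa> ^ j * y" for j y
    proof -
      have "\<kappa> ^ j \<le> 1" "0 \<le> \<kappa> ^ j"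
        using kappa_pos kappa_lt1 by (auto intro: power_le_one)
      then show ?thesis
        using mult_right_mono_neg[of "\<kappa> ^ j" 1 y] by (cases "0 \<le> y") auto
    qed
    show ?thesis
    proof (cases "even i")
      case True
      then have "T' = \<kappa> ^ i * \<tau>" by (simp add: T'_def)
      then show ?thesis using shrink[of \<tau> i] c by linarith
    next
      case False
      then obtain j where j: "i = Suc (2 * j)" by (metis oddE Suc_eq_plus1)
      then have "T' = \<kappa> ^ (2 * j) * (- \<kappa> * \<tau>)" by (simp add: T'_def power_mult)
      then show ?thesis using shrink[of "- \<kappa> * \<tau>" "2 * j"] c by linarith
    qed
  qed
  define D where "D = \<mu> + \<kappa> - s"
  have D: "\<mu> \<le> D" "0 < D" using s mu_gt1 by (auto simp: D_def)
  define s' where "s' = \<kappa> * \<mu> / D"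
  have s': "s' \<le> \<kappa>" "0 \<le> s'"
    using D kappa_pos mu_gt1 by (auto simp: s'_def field_simps)
  \<comment> \<open>\<open>\<kappa>\<close> is fixed by the slope map sending \<open>s\<close> to
    \<open>\<kappa> * \<mu> / (\<mu> + \<kappa> - s)\<close>; since \<open>D > 1\<close>, the
    distance to it shrinks by the factor \<open>\<kappa>\<close>.\<close>
  have "\<bar>s' - \<kappa>\<bar> \<le> \<kappa> * \<bar>s - \<kappa>\<bar>"
  proof -
    have "s' - \<kappa> = \<kappa> * ((s - \<kappa>) / D)" using D by (simp add: s'_def D_def field_simps)
    moreover have "\<bar>(s - \<kappa>) / D\<bar> \<le> \<bar>s - \<kappa>\<bar>"
      using D mu_gt1 mult_right_mono[of 1 D "\<bar>s - \<kappa>\<bar>"] by (simp add: abs_divide divide_le_eq mult.commute)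
    ultimately show ?thesis
      using kappa_pos mult_left_mono[of "\<bar>(s - \<kappa>) / D\<bar>" "\<bar>s - \<kappa>\<bar>" \<kappa>] by (simp add: abs_mult)
  qed
  also have "\<dots> \<le> \<kappa> * (\<kappa> ^ i * (2 * \<kappa>))" using s kappa_pos by simp
  finally have s2: "\<bar>s' - \<kappa>\<bar> \<le> \<kappa> ^ Suc i * (2 * \<kappa>)" by (simp add: mult.assoc)
  have "(x0 + (- \<kappa>) ^ Suc i * \<tau> + t, - (\<kappa> * \<mu> * x0) + \<mu> * ((- \<kappa>) ^ Suc i * \<tau>) + s' * t) \<in> (f ^^ Suc i) ` J"
    if t: "\<bar>t\<bar> \<le> min c (\<mu> ^ Suc i * d)" for t
  proof -
    \<comment> \<open>The offset of the preimage; dividing by \<open>D \<ge> \<mu>\<close> brings it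
      into the range of the induction hypothesis.\<close>
    define u where "u = - t / D"
    have tu: "t = - D * u" using D by (simp add: u_def)
    have "\<mu> * \<bar>u\<bar> \<le> \<bar>t\<bar>"
      using D by (simp add: tu abs_mult mult_right_mono)
    moreover have "1 * \<bar>u\<bar> \<le> \<mu> * \<bar>u\<bar>" using mu_gt1 by (intro mult_right_mono) auto
    ultimately have u: "\<bar>u\<bar> \<le> c" "\<mu> * \<bar>u\<bar> \<le> \<mu> * (\<mu> ^ i * d)" using t by auto
    then have "\<bar>u\<bar> \<le> min c (\<mu> ^ i * d)" using mu_gt1 by simp
    from st[OF this] have in_J: "(x0 + T' + u, - (\<kappa> * \<mu> * x0) + \<mu> * T' + s * u) \<in> (f ^^ i) ` J"
      by (simp add: T'_def)
    have "0 \<le> x0 + T' + u" using u(1) ci by linarith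
    then have "f (x0 + T' + u, - (\<kappa> * \<mu> * x0) + \<mu> * T' + s * u) =
      (1 - \<kappa> * \<mu> * x0 + \<mu> * T' + s * u - (\<mu> + \<kappa>) * (x0 + T' + u), - (\<kappa> * \<mu> * (x0 + T' + u)))"
      by (simp add: lozi_def)
    also have "1 - \<kappa> * \<mu> * x0 + \<mu> * T' + s * u - (\<mu> + \<kappa>) * (x0 + T' + u) = x0 - \<kappa> * T' + t"
      using x0_eq by (simp add: tu D_def algebra_simps)
    also have "- (\<kappa> * \<mu> * (x0 + T' + u)) = - (\<kappa> * \<mu> * x0) + \<mu> * (- \<kappa> * T') + s' * t"
      using D by (simp add: tu s'_def algebra_simps)
    finally show ?thesis
      using imageI[OF in_J, of f] by (simp add: T'_def image_comp mult.assoc)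
  qed
  then show ?case using s' s2 by (intro exI[of _ s']) (auto simp del: funpow.simps power_Suc)
qed

text \<open>Some image of the segment crosses the stable line, and \<open>inclination\<close>
  spreads the later images along the unstable line. That this holds for all large \<open>i\<close>
  is what yields mixing and not mere transitivity.\<close>

lemma accumulates:
  assumes "l < r" "seg m \<kappa> l r \<subseteq> T"
  obtains c where "0 < c" "\<And>t \<rho>. \<bar>t\<bar> < c \<Longrightarrow> 0 < \<rho> \<Longrightarrow>
    \<forall>\<^sub>F i in sequentially. \<exists>z\<in>(f ^^ i) ` seg m \<kappa> l r. dist z (x0 + t, - (\<kappa> * \<mu> * x0) + \<kappa> * t) < \<rho>"
proof -
  let ?J = "seg m \<kappa> l r"
  obtain n m' s p where 1: "\<bar>s\<bar> \<le> \<kappa>" "0 < p" "m' + s * p = 0" "(0, p - 1) \<in> T"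
    "seg m' s 0 p \<subseteq> (f ^^ Suc n) ` ?J"
    using seg_joins_axes[OF _ assms] kappa_pos by (metis abs_of_pos order_refl)
  have "(0, m') \<in> seg m' s 0 p" using 1 by (force simp: seg_def)
  then have "(0, m') \<in> T" using 1(5) f_pow_T[OF assms(2)] by blast
  then obtain \<tau> where \<tau>: "0 < x0 + \<tau>" "x0 + \<tau> < p" "0 < x0 - \<kappa> * \<tau>"
    "m' + s * (x0 + \<tau>) = - (\<kappa> * \<mu> * x0) + \<mu> * \<tau>"
    using crosses_stable_line[OF 1(1-4)] by blast
  \<comment> \<open>\<open>c\<close> is the least distance from the vertical axis among
    \<open>X\<close>, the crossing point and its image; \<open>d\<close> is the horizontal distance
    from the crossing point to the nearer end of the segment.\<close>
  define c where "c = min x0 (min (x0 + \<tau>) (x0 - \<kappa> * \<tau>))"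
  define d where "d = min (x0 + \<tau>) (p - (x0 + \<tau>))"
  have c: "0 < c" "c \<le> x0" "c \<le> x0 + \<tau>" "c \<le> x0 - \<kappa> * \<tau>" and d: "0 < d"
    using \<tau> x0_pos by (auto simp: c_def d_def)
  have J: "(x0 + \<tau> + t, - (\<kappa> * \<mu> * x0) + \<mu> * \<tau> + s * t) \<in> (f ^^ Suc n) ` ?J"
    if "\<bar>t\<bar> \<le> min c d" for t
  proof -
    have "(x0 + \<tau> + t, m' + s * (x0 + \<tau> + t)) \<in> seg m' s 0 p"
      unfolding seg_def using that by (intro image_eqI[of _ _ "x0 + \<tau> + t"]) (auto simp: d_def)
    moreover have "m' + s * (x0 + \<tau> + t) = - (\<kappa> * \<mu> * x0) + \<mu> * \<tau> + s * t"
      using \<tau>(4) by (simp add: algebra_simps)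
    ultimately show ?thesis using 1(5) by auto
  qed
  have "\<forall>\<^sub>F i in sequentially. \<exists>z\<in>(f ^^ i) ` ?J. dist z (x0 + t, - (\<kappa> * \<mu> * x0) + \<kappa> * t) < \<rho>"
    if t: "\<bar>t\<bar> < c" and "0 < \<rho>" for t \<rho>
  proof -
    have "\<forall>i. \<exists>s'. \<bar>s' - \<kappa>\<bar> \<le> \<kappa> ^ i * (2 * \<kappa>) \<and>
       (\<forall>t. \<bar>t\<bar> \<le> min c (\<mu> ^ i * d) \<longrightarrow> (x0 + (- \<kappa>) ^ i * \<tau> + t,
         - (\<kappa> * \<mu> * x0) + \<mu> * ((- \<kappa>) ^ i * \<tau>) + s' * t) \<in> (f ^^ i) ` (f ^^ Suc n) ` ?J)"
      using inclination[OF 1(1) c(2-4) less_imp_le[OF d] J] by blast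
    then obtain s' where s': "\<And>i. \<bar>s' i - \<kappa>\<bar> \<le> \<kappa> ^ i * (2 * \<kappa>)"
      "\<And>i t. \<bar>t\<bar> \<le> min c (\<mu> ^ i * d) \<Longrightarrow> (x0 + (- \<kappa>) ^ i * \<tau> + t,
         - (\<kappa> * \<mu> * x0) + \<mu> * ((- \<kappa>) ^ i * \<tau>) + s' i * t) \<in> (f ^^ i) ` (f ^^ Suc n) ` ?J"
      unfolding choice_iff by blast
    define z where "z i = (x0 + (- \<kappa>) ^ i * \<tau> + t,
         - (\<kappa> * \<mu> * x0) + \<mu> * ((- \<kappa>) ^ i * \<tau>) + s' i * t)" for i
    have k0: "(\<lambda>i. (- \<kappa>) ^ i) \<longlonglongrightarrow> 0" "(\<lambda>i. \<kappa> ^ i) \<longlonglongrightarrow> 0"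
      using kappa_pos kappa_lt1 by (auto intro: LIMSEQ_power_zero)
    have "(\<lambda>i. \<kappa> ^ i * (2 * \<kappa>)) \<longlonglongrightarrow> 0 * (2 * \<kappa>)"
      by (intro tendsto_intros k0)
    then have k1: "(\<lambda>i. \<kappa> ^ i * (2 * \<kappa>)) \<longlonglongrightarrow> 0" by (simp only: mult_zero_left)
    have "(\<lambda>i. s' i - \<kappa>) \<longlonglongrightarrow> 0"
    proof (rule Lim_null_comparison[OF _ k1])
      show "\<forall>\<^sub>F i in sequentially. norm (s' i - \<kappa>) \<le> \<kappa> ^ i * (2 * \<kappa>)"
        unfolding real_norm_def by (intro always_eventually allI s'(1))
    qed
    then have "s' \<longlonglongrightarrow> \<kappa>" by (simp add: LIM_zero_iff)
    then have "z \<longlonglongrightarrow> (x0 + 0 * \<tau> + t, - (\<kappa> * \<mu> * x0) + \<mu> * (0 * \<tau>) + \<kappa> * t)"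
      unfolding z_def by (intro tendsto_intros k0)
    then have "\<forall>\<^sub>F i in sequentially. dist (z i) (x0 + t, - (\<kappa> * \<mu> * x0) + \<kappa> * t) < \<rho>"
      using \<open>0 < \<rho>\<close> by (simp add: tendsto_iff)
    moreover have "\<forall>\<^sub>F i in sequentially. z i \<in> (f ^^ (i + Suc n)) ` ?J"
    proof -
      \<comment> \<open>From step \<open>j\<close> on the pieces have full half-width
        \<open>c\<close> and so contain the offset \<open>t\<close>.\<close>
      obtain j where j: "c / d < \<mu> ^ j" using real_arch_pow[OF mu_gt1] by blast
      have "z i \<in> (f ^^ (i + Suc n)) ` ?J" if "j \<le> i" for i
      proof -
        have "\<mu> ^ j \<le> \<mu> ^ i" using that mu_gt1 by (intro power_increasing) auto
        then have "c < \<mu> ^ i * d" using j d by (smt (verit) divide_less_eq mult_right_mono)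
        then have "z i \<in> (f ^^ i) ` (f ^^ Suc n) ` ?J"
          unfolding z_def using t by (intro s'(2)) auto
        then show ?thesis by (simp only: funpow_add image_comp)
      qed
      then show ?thesis by (auto simp: eventually_sequentially)
    qed
    ultimately have "\<forall>\<^sub>F i in sequentially. \<exists>z\<in>(f ^^ (i + Suc n)) ` ?J.
        dist z (x0 + t, - (\<kappa> * \<mu> * x0) + \<kappa> * t) < \<rho>"
      by eventually_elim blast
    then show ?thesis
      by (rule eventually_sequentially_seg[THEN iffD1])
  qed
  with c(1) show thesis by (rule that)
qed

section \<open>Points of the unstable manifold\<close>

text \<open>The unstable manifold of \<open>X\<close>, in the form given by
  \<open>unstable_manifold_fixpoint\<close>.\<close>

abbreviation W :: "(real \<times> real) set" where
  "W \<equiv> {r. (\<lambda>n. (inv f ^^ n) r) \<longlonglongrightarrow> X}"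

lemma inv_f [simp]: "inv f (f x) = x" "f (inv f x) = x"
  using bij_f by (auto simp: bij_is_inj bij_is_surj surj_f_inv_f)

lemma inv_f_pow: "(f ^^ n) ((inv f ^^ n) x) = x"
  by (induction n arbitrary: x) (simp_all add: funpow_swap1)

lemma f_W: "r \<in> W \<Longrightarrow> f r \<in> W"
proof -
  assume "r \<in> W"
  then have "(\<lambda>n. (inv f ^^ Suc n) (f r)) \<longlonglongrightarrow> X"
    by (simp add: funpow_Suc_right del: funpow.simps)
  then show ?thesis unfolding mem_Collect_eq by (rule LIMSEQ_imp_Suc)
qed

lemma f_pow_W: "r \<in> W \<Longrightarrow> (f ^^ n) r \<in> W"
  by (induction n) (use f_W in auto)

text \<open>Along the line of slope \<open>\<kappa>\<close> through \<open>X\<close>,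
  \<open>inv f\<close> multiplies the offset by \<open>- 1 / \<mu>\<close>, as long as the points
  are not left of the vertical axis.\<close>

lemma unstable_line_W:
  assumes "\<bar>t\<bar> \<le> x0"
  shows "(x0 + t, - (\<kappa> * \<mu> * x0) + \<kappa> * t) \<in> W"
proof -
  have step: "inv f (x0 + u, - (\<kappa> * \<mu> * x0) + \<kappa> * u) =
      (x0 + - u / \<mu>, - (\<kappa> * \<mu> * x0) + \<kappa> * (- u / \<mu>))" if "\<bar>u\<bar> \<le> x0" for u
  proof -
    have "\<bar>- u / \<mu>\<bar> \<le> \<bar>u\<bar>"
      using mu_gt1 mult_right_mono[of 1 \<mu> "\<bar>u\<bar>"] by (simp add: divide_le_eq mult.commute)
    then have "0 \<le> x0 + - u / \<mu>" using that by linarith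
    then have "f (x0 + - u / \<mu>, - (\<kappa> * \<mu> * x0) + \<kappa> * (- u / \<mu>)) =
      (1 + (- (\<kappa> * \<mu> * x0) + \<kappa> * (- u / \<mu>)) - (\<mu> + \<kappa>) * (x0 + - u / \<mu>), - (\<kappa> * \<mu> * (x0 + - u / \<mu>)))"
      by (simp add: lozi_def)
    also have "1 + (- (\<kappa> * \<mu> * x0) + \<kappa> * (- u / \<mu>)) - (\<mu> + \<kappa>) * (x0 + - u / \<mu>) =
       (1 - \<kappa> * \<mu> * x0 - (\<mu> + \<kappa>) * x0) + u"
      using mu_gt1 by (simp add: field_simps)
    also have "\<dots> = x0 + u" using x0_eq by simp
    also have "- (\<kappa> * \<mu> * (x0 + - u / \<mu>)) = - (\<kappa> * \<mu> * x0) + \<kappa> * u"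
      using mu_gt1 by (simp add: field_simps)
    finally show ?thesis by (metis inv_f(1))
  qed
  have small: "\<bar>t / (- \<mu>) ^ n\<bar> \<le> x0" for n
  proof -
    have "1 \<le> \<mu> ^ n" using mu_gt1 by simp
    then have "\<bar>t / (- \<mu>) ^ n\<bar> \<le> \<bar>t\<bar>"
      using mult_right_mono[of 1 "\<mu> ^ n" "\<bar>t\<bar>"] mu_gt1
      by (simp add: abs_divide power_abs divide_le_eq mult.commute)
    then show ?thesis using assms by linarith
  qed
  have "(inv f ^^ n) (x0 + t, - (\<kappa> * \<mu> * x0) + \<kappa> * t) =
      (x0 + t / (- \<mu>) ^ n, - (\<kappa> * \<mu> * x0) + \<kappa> * (t / (- \<mu>) ^ n))" for n
  proof (induction n)
    case (Suc n)
    then show ?case using step[OF small[of n]] mu_gt1 by (simp add: field_simps)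
  qed simp
  moreover have "(\<lambda>n. (x0 + t / (- \<mu>) ^ n, - (\<kappa> * \<mu> * x0) + \<kappa> * (t / (- \<mu>) ^ n)))
      \<longlonglongrightarrow> (x0 + 0, - (\<kappa> * \<mu> * x0) + \<kappa> * 0)"
  proof -
    have "(\<lambda>n. t * (1 / (- \<mu>)) ^ n) \<longlonglongrightarrow> t * 0"
      using mu_gt1 by (intro tendsto_intros LIMSEQ_power_zero) auto
    then have "(\<lambda>n. t / (- \<mu>) ^ n) \<longlonglongrightarrow> 0"
      by (simp only: power_one_over times_divide_eq_right mult_1_right mult_zero_right)
    then show ?thesis by (intro tendsto_intros)
  qed
  ultimately show ?thesis
    by (simp add: X_eq)
qed

text \<open>A backward orbit converging to \<open>X\<close> must end up on the unstable line: any
  deviation from it would be magnified by \<open>1 / \<kappa>\<close> in every backward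
  step.\<close>

lemma W_from_unstable_line:
  assumes "r \<in> W" "0 < \<delta>"
  obtains n t where "\<bar>t\<bar> < \<delta>" "r = (f ^^ n) (x0 + t, - (\<kappa> * \<mu> * x0) + \<kappa> * t)"
proof -
  define w where "w n = (inv f ^^ n) r" for n
  have lim: "w \<longlonglongrightarrow> X" using assms by (simp add: w_def[abs_def])
  have fw: "f (w (Suc n)) = w n" for n by (simp add: w_def)
  \<comment> \<open>Closer than \<open>x0\<close> to \<open>X\<close> the first coordinate is
    positive, so the affine formula for \<open>f\<close> is available.\<close>
  obtain N where N: "\<And>n. n \<ge> N \<Longrightarrow> dist (w n) X < min \<delta> x0"
    using lim assms(2) x0_pos unfolding lim_sequentially by (metis min_less_iff_conj)
  have fst: "\<bar>fst (w n) - x0\<bar> < min \<delta> x0" if "n \<ge> N" for n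
    using N[OF that] dist_fst_le[of "w n" X] by (simp add: X_eq dist_real_def)
  txt \<open>The deviation from the unstable line is multiplied by \<open>- \<kappa>\<close> in each step.\<close>
  define \<phi> where "\<phi> p = snd p + \<kappa> * \<mu> * x0 - \<kappa> * (fst p - x0)" for p :: "real \<times> real"
  have step: "\<phi> (w n) = - \<kappa> * \<phi> (w (Suc n))" if "n \<ge> N" for n
  proof -
    obtain x y where xy: "w (Suc n) = (x, y)" by force
    have "0 \<le> x" using fst[of "Suc n"] that xy by auto
    then have "w n = (1 + y - (\<mu> + \<kappa>) * x, - (\<kappa> * \<mu> * x))"
      using fw[of n] by (simp add: xy lozi_def)
    then have "\<phi> (w n) = - (\<kappa> * \<mu> * x) + \<kappa> * \<mu> * x0 - \<kappa> * (1 + y - (\<mu> + \<kappa>) * x - x0)"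
      by (simp add: \<phi>_def)
    also have "\<dots> = - \<kappa> * (y + \<kappa> * \<mu> * x0 - \<kappa> * (x - x0)) + \<kappa> * (x0 - (1 - \<kappa> * \<mu> * x0 - (\<mu> + \<kappa>) * x0))"
      by (simp add: algebra_simps)
    also have "\<dots> = - \<kappa> * \<phi> (w (Suc n))" by (simp add: x0_eq \<phi>_def xy)
    finally show ?thesis .
  qed
  have "\<phi> (w N) = (- \<kappa>) ^ j * \<phi> (w (j + N))" for j
  proof (induction j)
    case (Suc j)
    have "\<phi> (w (j + N)) = - \<kappa> * \<phi> (w (Suc (j + N)))" by (rule step) simp
    with Suc show ?case by simp
  qed simp
  moreover have "(\<lambda>j. (- \<kappa>) ^ j * \<phi> (w (j + N))) \<longlonglongrightarrow> 0 * \<phi> X"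
    unfolding \<phi>_def using kappa_pos kappa_lt1
    by (intro tendsto_intros LIMSEQ_power_zero LIMSEQ_ignore_initial_segment[OF lim]) auto
  ultimately have "\<phi> (w N) = 0"
    by (metis (no_types, lifting) LIMSEQ_const_iff LIMSEQ_unique ext mult_zero_left tendsto_const)
  then have "w N = (x0 + (fst (w N) - x0), - (\<kappa> * \<mu> * x0) + \<kappa> * (fst (w N) - x0))"
    by (simp add: \<phi>_def prod_eq_iff)
  moreover have "r = (f ^^ N) (w N)" by (simp add: w_def inv_f_pow)
  ultimately show thesis using that[of "fst (w N) - x0" N] fst[of N] by auto
qed

section \<open>Mixing\<close>

text \<open>Both sets are pulled back to the unstable line: \<open>U\<close> contains the image
  under \<open>f ^^ n\<close> of a short segment \<open>J\<close> near \<open>X\<close>, and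
  \<open>V\<close> contains the image under \<open>f ^^ N\<close> of a point close to
  \<open>X\<close>. \<open>accumulates\<close> brings the images of \<open>J\<close> to that
  point.\<close>

lemma mixing_W: "topologically_mixing_on W f"
  unfolding topologically_mixing_on_def
proof (intro conjI allI impI)
  show "f ` W \<subseteq> W" using f_W by blast
  fix U V assume UV: "openin (top_of_set W) U \<and> openin (top_of_set W) V \<and> U \<noteq> {} \<and> V \<noteq> {}"
  then obtain O1 O2 where O: "open O1" "U = W \<inter> O1" "open O2" "V = W \<inter> O2"
    unfolding openin_open by blast
  obtain u v where uv: "u \<in> U" "v \<in> V" using UV by blast
  define P where "P t = (x0 + t, - (\<kappa> * \<mu> * x0) + \<kappa> * t)" for t
  obtain \<delta> where \<delta>: "0 < \<delta>" "\<And>t. \<bar>t\<bar> < \<delta> \<Longrightarrow> P t \<in> T"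
    using X_nbhd_T by (auto simp: P_def)
  have "u \<in> W" "v \<in> W" using uv O by blast+
  have "0 < min \<delta> x0" using \<delta>(1) x0_pos by simp
  then obtain n t where nt: "\<bar>t\<bar> < min \<delta> x0" "u = (f ^^ n) (P t)"
    using W_from_unstable_line[OF \<open>u \<in> W\<close>, folded P_def] by blast
  have "continuous_on UNIV (\<lambda>t. (f ^^ n) (P t))"
    unfolding P_def by (intro continuous_on_compose2[OF continuous_f_pow] continuous_intros) auto
  then have "open ((\<lambda>t. (f ^^ n) (P t)) -` O1)"
    using O(1) by (simp add: open_vimage)
  then obtain e where e: "0 < e" "ball t e \<subseteq> (\<lambda>t. (f ^^ n) (P t)) -` O1"
    using nt uv O(2) open_contains_ball_eq by (metis Int_iff vimageI)
  \<comment> \<open>\<open>e\<close> sends \<open>J\<close> into \<open>O1\<close> under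
    \<open>f ^^ n\<close>; \<open>\<delta>\<close> and \<open>x0\<close> put \<open>J\<close> inside
    \<open>T\<close> and \<open>W\<close>.\<close>
  define h where "h = min (e / 2) ((min \<delta> x0 - \<bar>t\<bar>) / 2)"
  have h: "0 < h" using e nt by (simp add: h_def)
  define J where "J = seg (- (\<kappa> * \<mu> * x0) - \<kappa> * x0) \<kappa> (x0 + t - h) (x0 + t + h)"
  have JP: "\<exists>t'. z = P t' \<and> \<bar>t' - t\<bar> < e \<and> \<bar>t'\<bar> < min \<delta> x0" if "z \<in> J" for z
  proof -
    obtain x where x: "x0 + t - h \<le> x" "x \<le> x0 + t + h" "z = (x, - (\<kappa> * \<mu> * x0) - \<kappa> * x0 + \<kappa> * x)"
      using \<open>z \<in> J\<close> by (auto simp: J_def seg_def)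
    have "z = P (x - x0)" by (simp add: P_def x algebra_simps)
    moreover have "\<bar>x - x0 - t\<bar> \<le> h" using x by linarith
    moreover have "h \<le> e / 2" "h \<le> (min \<delta> x0 - \<bar>t\<bar>) / 2"
      unfolding h_def by (rule min.cobounded1, rule min.cobounded2)
    moreover have "\<bar>t\<bar> + (M - \<bar>t\<bar>) / 2 < M" if "\<bar>t\<bar> < M" for M using that by (simp add: field_simps)
    from this[OF nt(1)] have "\<bar>t\<bar> + (min \<delta> x0 - \<bar>t\<bar>) / 2 < min \<delta> x0" .
    moreover have "\<bar>x - x0\<bar> \<le> \<bar>t\<bar> + h" using x by linarith
    ultimately have "\<bar>x - x0 - t\<bar> < e" "\<bar>x - x0\<bar> < min \<delta> x0" using e(1) by linarith+
    with \<open>z = P (x - x0)\<close> show ?thesis by blast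
  qed
  have JT: "J \<subseteq> T" using JP \<delta>(2) by fastforce
  have JW: "J \<subseteq> W"
  proof
    fix z assume "z \<in> J"
    then obtain t' where "z = P t'" "\<bar>t'\<bar> < min \<delta> x0" using JP by blast
    then show "z \<in> W" using unstable_line_W[of t'] unfolding P_def by simp
  qed
  have JU: "(f ^^ n) ` J \<subseteq> U"
  proof
    fix z assume "z \<in> (f ^^ n) ` J"
    then obtain w where w: "w \<in> J" "z = (f ^^ n) w" by blast
    then obtain t' where t': "w = P t'" "\<bar>t' - t\<bar> < e" using JP by blast
    then have "t' \<in> ball t e" by (simp add: dist_real_def abs_minus_commute)
    then have "z \<in> O1" using e w t' by auto
    moreover have "z \<in> W" using f_pow_W w JW by blast
    ultimately show "z \<in> U" using O by blast
  qed
  obtain c where c: "0 < c" "\<And>t \<rho>. \<bar>t\<bar> < c \<Longrightarrow> 0 < \<rho> \<Longrightarrow>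
      \<forall>\<^sub>F i in sequentially. \<exists>z\<in>(f ^^ i) ` J. dist z (P t) < \<rho>"
    using accumulates[of "x0 + t - h" "x0 + t + h" "- (\<kappa> * \<mu> * x0) - \<kappa> * x0"] h JT
    unfolding J_def P_def by auto
  \<comment> \<open>The range \<open>c\<close> depends on \<open>J\<close>, so \<open>v\<close> is
    pulled back only now, to an offset below \<open>c\<close>.\<close>
  obtain N t' where t': "\<bar>t'\<bar> < c" "v = (f ^^ N) (P t')"
    using W_from_unstable_line[OF \<open>v \<in> W\<close> c(1), folded P_def] by blast
  have "open ((f ^^ N) -` O2)"
    using O(3) continuous_f_pow by (simp add: open_vimage)
  moreover have "P t' \<in> (f ^^ N) -` O2" using uv(2) O(4) t'(2) by simp
  ultimately obtain \<rho> where \<rho>: "0 < \<rho>" "ball (P t') \<rho> \<subseteq> (f ^^ N) -` O2"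
    using open_contains_ball_eq by metis
  obtain I where I: "\<And>i. i \<ge> I \<Longrightarrow> \<exists>z\<in>(f ^^ i) ` J. dist z (P t') < \<rho>"
    using c(2)[OF t'(1) \<rho>(1)] by (auto simp: eventually_sequentially)
  have "(f ^^ i) ` U \<inter> V \<noteq> {}" if "i \<ge> I + N" for i
  proof -
    \<comment> \<open>\<open>i \<ge> I + N\<close> makes this truncated subtraction a genuine
      one.\<close>
    have "I \<le> i + n - N" using that by arith
    then obtain z where z: "z \<in> J" "dist ((f ^^ (i + n - N)) z) (P t') < \<rho>"
      using I by blast
    then have "(f ^^ (i + n - N)) z \<in> ball (P t') \<rho>" by (simp add: dist_commute)
    then have "(f ^^ N) ((f ^^ (i + n - N)) z) \<in> O2" using \<rho>(2) by blast
    moreover have "(f ^^ N) ((f ^^ (i + n - N)) z) = (f ^^ i) ((f ^^ n) z)"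
    proof -
      have "N + (i + n - N) = i + n" using that by simp
      then show ?thesis by (metis comp_apply funpow_add)
    qed
    moreover have "(f ^^ i) ((f ^^ n) z) \<in> W" using f_pow_W JW z(1) by blast
    ultimately have "(f ^^ i) ((f ^^ n) z) \<in> (f ^^ i) ` U \<inter> V"
      using JU z(1) O(4) by auto
    then show ?thesis by blast
  qed
  then have "{i. (f ^^ i) ` U \<inter> V = {}} \<subseteq> {..<I + N}"
    by (metis (mono_tags, lifting) lessThan_iff linorder_not_le mem_Collect_eq subsetI)
  then show "finite {i. (f ^^ i) ` U \<inter> V = {}}"
    using finite_subset by blast
qed

end

section \<open>From the parameters to the eigenvalues\<close>

theorem theorem4p8:
  fixes a b \<epsilon> :: real
  assumes "sqrt 2 < a" and "a < 2"
    and "(if 9 * a ^ 4 - 16 * a ^ 3 \<ge> 0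
          then max (1 / 8 * (3 * a ^ 2 - 8 * a + sqrt (9 * a ^ 4 - 16 * a ^ 3))) (2 - sqrt 2 * a)
          else 2 - sqrt 2 * a) < b"
    and "b < 0"
    and "\<epsilon> > 0"
  shows "topologically_mixing_on
           (unstable_manifold (lozi a b) \<epsilon> (lozi_fixpoint a b)) (lozi a b)"
proof -
  have b: "2 - sqrt 2 * a < b" using assms(3) by (auto split: if_splits)
  have "sqrt 2 < (3/2 :: real)"
    by (rule real_less_lsqrt) (auto simp: power2_eq_square)
  then have sqrt2: "sqrt 2 * sqrt 2 = (2::real)" "1 < sqrt (2::real)" "sqrt 2 < (3/2 :: real)"
    by auto
  have apos: "0 < a" using assms(1) sqrt2 by linarith
  \<comment> \<open>Equivalent to \<open>2 - sqrt 2 * a < b\<close>; it yields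
    \<open>D > 2 * sqrt 2 - a\<close>, that is, \<open>\<mu> > sqrt 2\<close>.\<close>
  have disc: "(2 * sqrt 2 - a)\<^sup>2 < a\<^sup>2 + 4 * b"
    using b sqrt2 by (simp add: power2_eq_square algebra_simps)
  define D where "D = sqrt (a\<^sup>2 + 4 * b)"
  have D2: "D\<^sup>2 = a\<^sup>2 + 4 * b"
    using disc unfolding D_def by (smt (verit) real_sqrt_pow2 zero_le_power2)
  have D1: "2 * sqrt 2 - a < D" unfolding D_def using disc by (rule real_less_rsqrt)
  have Da: "D < a" unfolding D_def using assms(4) apos by (intro real_less_lsqrt) auto
  \<comment> \<open>\<open>- \<mu>\<close> and \<open>- \<kappa>\<close> are the roots of
    \<open>z\<^sup>2 + a * z - b\<close>, the characteristic polynomial at \<open>X\<close>.\<close>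
  define \<mu> \<kappa> where "\<mu> = (a + D) / 2" and "\<kappa> = (a - D) / 2"
  have a: "a = \<mu> + \<kappa>" by (simp add: \<mu>_def \<kappa>_def field_simps)
  have bb: "b = - (\<kappa> * \<mu>)"
    using D2 by (simp add: \<mu>_def \<kappa>_def power2_eq_square field_simps)
  \<comment> \<open>In \<open>a\<close> and \<open>D\<close>, \<open>trap\<close> reads
    \<open>a * D < 4 * a + 4 * b - a\<^sup>2\<close>. The quantity here is four times the difference
    of the squares of the two sides; it is positive at once if the radicand is negative.\<close>
  have quad: "0 < (8 * b - 3 * a\<^sup>2 + 8 * a)\<^sup>2 - (9 * a ^ 4 - 16 * a ^ 3)"
  proof (cases "9 * a ^ 4 - 16 * a ^ 3 \<ge> 0")
    case True
    then have "sqrt (9 * a ^ 4 - 16 * a ^ 3) < 8 * b - 3 * a\<^sup>2 + 8 * a"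
      using assms(3) by auto
    then show ?thesis
      using True real_sqrt_pow2[OF True] power_strict_mono[of "sqrt (9 * a ^ 4 - 16 * a ^ 3)" _ 2]
      by (smt (verit) pos2 real_sqrt_ge_zero)
  qed (smt (verit) zero_le_power2)
  \<comment> \<open>Positivity of the right side allows the squares to be compared.\<close>
  have pos: "0 < 4 * a + 4 * b - a\<^sup>2"
  proof -
    have "sqrt 2 * a \<le> 3/2 * a" "a * a \<le> 2 * a"
      using sqrt2 assms apos by (auto intro: mult_right_mono)
    then show ?thesis using b assms unfolding power2_eq_square by linarith
  qed
  have "(a * D)\<^sup>2 < (4 * a + 4 * b - a\<^sup>2)\<^sup>2"
    using quad D2 by (simp add: power_mult_distrib) (simp add: power2_eq_square power3_eq_cube power4_eq_xxxx algebra_simps)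
  then have "a * D < 4 * a + 4 * b - a\<^sup>2"
    by (rule power_less_imp_less_base) (use pos in linarith)
  then have "\<mu>\<^sup>2 + 3 * \<kappa> * \<mu> < 2 * (\<mu> + \<kappa>)"
    using D2 by (simp add: \<mu>_def \<kappa>_def power2_eq_square field_simps)
  then interpret lozi_eigenvalues \<mu> \<kappa>
    using D1 Da by unfold_locales (auto simp: \<mu>_def \<kappa>_def)
  show ?thesis
    using mixing_W unstable_manifold_fixpoint[OF bij_f f_X assms(5)] by (simp add: a bb)
qed

end
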